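(* Let $X$ and $Y$ be finite $T_0$-spaces and let $f,g\colon X\to Y$ be continuous maps. (a) If $f\leq g$, then $\mathcal{U}(f)\leq \mathcal{U}(g)$ and $\mathcal{F}(f)\leq \mathcal{F}(g)$. (b) If $f\leq g$ and $\mathcal{U}(X)\cap \mathcal{F}(X)=\varnothing$, then $\mathcal{C}(f)\leq \mathcal{C}(g)$. (c) If $f\simeq g$, then $\mathcal{U}(f)\simeq \mathcal{U}(g)$ and $\mathcal{F}(f)\simeq \mathcal{F}(g)$. (d) If $f\simeq g$ and $\mathcal{U}(X)\cap \mathcal{F}(X)=\varnothing$, then $\mathcal{C}(f)\simeq \mathcal{C}(g)$.
   Context: A finite $T_0$-space is identified with a finite poset: $x\le y$ iff $U_x\subseteq U_y$, where $U_x=\{z\mid z\le x\}$ is the minimal open set containing $x$; $F_x=\{z\mid z\ge x\}$ is the smallest closed set containing $x$. Open sets are the down-sets, and continuous maps are the order-preserving maps. Maps into a poset are compared pointwise, and $\simeq$ denotes homotopy of continuous maps. $\mathrm{mxl}(X)$ and $\mathrm{mnl}(X)$ are the sets of maximal and minimal elements of $X$. For a non-empty subset $A\subseteq X$ let $U_A=\bigcap_{a\in A}U_a$ and $F_A=\bigcap_{a\in A}F_a$. $\mathcal{U}(X)$ is the set of all connected components of the non-empty sets $U_A$ with $\varnothing\ne A\subseteq \mathrm{mxl}(X)$; $\mathcal{F}(X)$ is the set of all connected components of the non-empty sets $F_A$ with $\varnothing\neq A\subseteq\mathrm{mnl}(X)$. $\mathcal{U}(X)$ is the poset (finite $T_0$-space)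 ordered by $\subseteq$, and $\mathcal{F}(X)$ is the poset ordered by $\supseteq$ (that is, $C_1\le C_2$ iff $C_1\supseteq C_2$). $\mathcal{C}(X)$ is the poset with underlying set $\mathcal{U}(X)\cup\mathcal{F}(X)$ where $C_1\le C_2$ iff one of the following holds: $C_1,C_2\in\mathcal{U}(X)$ and $C_1\subseteq C_2$; $C_1,C_2\in\mathcal{F}(X)$ and $C_1\supseteq C_2$; $C_1\in\mathcal{F}(X)$, $C_2\in\mathcal{U}(X)$ and $C_1\cap C_2\ne\varnothing$. For a continuous map $f\colon X\to Y$: $\mathcal{U}(f)\colon\mathcal{U}(X)\to\mathcal{U}(Y)$, $\mathcal{U}(f)(C)=\min\{D\in\mathcal{U}(Y)\mid f(C)\subseteq D\}$ (minimum in the poset $\mathcal{U}(Y)$), and $\mathcal{F}(f)\colon\mathcal{F}(X)\to\mathcal{F}(Y)$, $\mathcal{F}(f)(C)=\max\{D\in\mathcal{F}(Y)\mid f(C)\subseteq D\}$ (maximum in the poset $\mathcal{F}(Y)$, i.e. the smallest such $D$ for inclusion); these exist and define continuous maps. If $\mathcal{U}(X)\cap\mathcal{F}(X)=\varnothing$, $\mathcal{C}(f)\colon\mathcal{C}(X)\to\mathcal{C}(Y)$ is the (continuous) map equal to $\mathcal{U}(f)$ on $\mathcal{U}(X)$ and to $\mathcal{F}(f)$ on $\mathcal{F}(X)$. *)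

theory Defs
  imports "HOL-Analysis.Analysis"
begin

text \<open>The minimal open set \<open>U\<^sub>x\<close> (which is itself open when the space is finite) and the
  smallest closed set \<open>F\<^sub>x\<close>.\<close>

definition min_open :: "'a topology \<Rightarrow> 'a \<Rightarrow> 'a set" where
  "min_open X x = \<Inter>{U. openin X U \<and> x \<in> U}"

definition min_closed :: "'a topology \<Rightarrow> 'a \<Rightarrow> 'a set" where
  "min_closed X x = X closure_of {x}"

definition space_le :: "'a topology \<Rightarrow> 'a \<Rightarrow> 'a \<Rightarrow> bool" where
  "space_le X x y \<longleftrightarrow>
     x \<in> topspace X \<and> y \<in> topspace X \<and> min_open X x \<subseteq> min_open X y"

definition mxl :: "'a topology \<Rightarrow> 'a set" where
  "mxl X = {x \<in> topspace X. \<forall>y. space_le X x y \<longrightarrow> y = x}"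

definition mnl :: "'a topology \<Rightarrow> 'a set" where
  "mnl X = {x \<in> topspace X. \<forall>y. space_le X y x \<longrightarrow> y = x}"

text \<open>The topology on a poset with carrier \<open>P\<close> whose open sets are the down-sets.\<close>

definition downset_topology :: "'a set \<Rightarrow> ('a \<Rightarrow> 'a \<Rightarrow> bool) \<Rightarrow> 'a topology" where
  "downset_topology P le =
     topology (\<lambda>S. S \<subseteq> P \<and> (\<forall>x\<in>S. \<forall>y\<in>P. le y x \<longrightarrow> y \<in> S))"

lemma openin_downset_topology:
  "openin (downset_topology P le) S \<longleftrightarrow> S \<subseteq> P \<and> (\<forall>x\<in>S. \<forall>y\<in>P. le y x \<longrightarrow> y \<in> S)"
proof -
  have "istopology (\<lambda>S. S \<subseteq> P \<and> (\<forall>x\<in>S. \<forall>y\<in>P. le y x \<longrightarrow> y \<in> S))"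
    unfolding istopology_def by blast
  then show ?thesis
    by (simp add: downset_topology_def topology_inverse')
qed

lemma topspace_downset_topology: "topspace (downset_topology P le) = P"
  by (auto simp: topspace_def openin_downset_topology)

text \<open>The sets \<open>U\<^sub>A\<close> and \<open>F\<^sub>A\<close>; only used for non-empty \<open>A\<close>.\<close>

definition U_of :: "'a topology \<Rightarrow> 'a set \<Rightarrow> 'a set" where
  "U_of X A = (\<Inter>a\<in>A. min_open X a)"

definition F_of :: "'a topology \<Rightarrow> 'a set \<Rightarrow> 'a set" where
  "F_of X A = (\<Inter>a\<in>A. min_closed X a)"

definition U_set :: "'a topology \<Rightarrow> 'a set set" where
  "U_set X = {C. \<exists>A. A \<noteq> {} \<and> A \<subseteq> mxl X \<and> U_of X A \<noteq> {} \<and>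
                     C \<in> connected_components_of (subtopology X (U_of X A))}"

definition F_set :: "'a topology \<Rightarrow> 'a set set" where
  "F_set X = {C. \<exists>A. A \<noteq> {} \<and> A \<subseteq> mnl X \<and> F_of X A \<noteq> {} \<and>
                     C \<in> connected_components_of (subtopology X (F_of X A))}"

definition C_set :: "'a topology \<Rightarrow> 'a set set" where
  "C_set X = U_set X \<union> F_set X"

text \<open>Inclusion on \<open>U_set\<close>, but reverse inclusion on \<open>F_set\<close>.\<close>

definition U_le :: "'a topology \<Rightarrow> 'a set \<Rightarrow> 'a set \<Rightarrow> bool" where
  "U_le X C1 C2 \<longleftrightarrow> C1 \<in> U_set X \<and> C2 \<in> U_set X \<and> C1 \<subseteq> C2"

definition F_le :: "'a topology \<Rightarrow> 'a set \<Rightarrow> 'a set \<Rightarrow> bool" where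
  "F_le X C1 C2 \<longleftrightarrow> C1 \<in> F_set X \<and> C2 \<in> F_set X \<and> C1 \<supseteq> C2"

definition C_le :: "'a topology \<Rightarrow> 'a set \<Rightarrow> 'a set \<Rightarrow> bool" where
  "C_le X C1 C2 \<longleftrightarrow>
     U_le X C1 C2 \<or> F_le X C1 C2 \<or>
     (C1 \<in> F_set X \<and> C2 \<in> U_set X \<and> C1 \<inter> C2 \<noteq> {})"

definition U_space :: "'a topology \<Rightarrow> 'a set topology" where
  "U_space X = downset_topology (U_set X) (U_le X)"

definition F_space :: "'a topology \<Rightarrow> 'a set topology" where
  "F_space X = downset_topology (F_set X) (F_le X)"

definition C_space :: "'a topology \<Rightarrow> 'a set topology" where
  "C_space X = downset_topology (C_set X) (C_le X)"

text \<open>Both induced maps pick the least admissible set for inclusion: this is the minimum in the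
  poset \<open>U_set Y\<close>, and the maximum in the poset \<open>F_set Y\<close>, whose order is reverse inclusion.\<close>

definition U_map :: "'b topology \<Rightarrow> ('a \<Rightarrow> 'b) \<Rightarrow> 'a set \<Rightarrow> 'b set" where
  "U_map Y f C = (LEAST D. D \<in> U_set Y \<and> f ` C \<subseteq> D)"

definition F_map :: "'b topology \<Rightarrow> ('a \<Rightarrow> 'b) \<Rightarrow> 'a set \<Rightarrow> 'b set" where
  "F_map Y f C = (LEAST D. D \<in> F_set Y \<and> f ` C \<subseteq> D)"

text \<open>Only meaningful when \<open>U_set X\<close> and \<open>F_set X\<close> are disjoint.\<close>

definition C_map :: "'a topology \<Rightarrow> 'b topology \<Rightarrow> ('a \<Rightarrow> 'b) \<Rightarrow> 'a set \<Rightarrow> 'b set" where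
  "C_map X Y f C = (if C \<in> U_set X then U_map Y f C else F_map Y f C)"

definition pointwise_le :: "'a set \<Rightarrow> ('b \<Rightarrow> 'b \<Rightarrow> bool) \<Rightarrow> ('a \<Rightarrow> 'b) \<Rightarrow> ('a \<Rightarrow> 'b) \<Rightarrow> bool" where
  "pointwise_le P le f g \<longleftrightarrow> (\<forall>x\<in>P. le (f x) (g x))"

abbreviation homotopic :: "'a topology \<Rightarrow> 'b topology \<Rightarrow> ('a \<Rightarrow> 'b) \<Rightarrow> ('a \<Rightarrow> 'b) \<Rightarrow> bool" where
  "homotopic X Y f g \<equiv> homotopic_with (\<lambda>_. True) X Y f g"

end

theory Submission
  imports Defs
begin

text \<open>
  Minimal open sets \<open>U\<^sub>x\<close> and minimal closed sets \<open>F\<^sub>x\<close> of a finite \<open>T\<^sub>0\<close>-space share the few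
  properties on which the argument rests: the \<^emph>\<open>cone\<close> of \<open>x\<close> is connected, contains \<open>x\<close>, contains
  the cones of all its points, and lies in a cone that is maximal for inclusion.  Both \<open>U_set\<close> and
  \<open>F_set\<close> consist of the components of intersections of maximal cones, called \<^emph>\<open>cells\<close> here, so
  the two halves of the theory are instances of one statement about cones (locale \<open>cone_family\<close>).

  Two facts about cells carry the order-theoretic part.  A non-empty connected set \<open>S\<close> inside some
  cone lies in a least cell: intersect \<^emph>\<open>all\<close> maximal cones around \<open>S\<close> and take the component
  containing \<open>S\<close> (\<open>ex_least_cell\<close>).  And a cell contains the cones of its points
  (\<open>cone_subset_cell\<close>).  Hence if every point of \<open>S\<close> lies in the cone of a point of \<open>T\<close>, then the
  least cell around \<open>S\<close> is contained in the one around \<open>T\<close> (\<open>cell_hull_mono\<close>).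
  For \<open>U_map\<close>, taking \<open>S = f ` C\<close> and \<open>T = g ` C\<close> gives monotonicity in the map, and taking
  \<open>S = f ` C\<close> and \<open>T = f ` C'\<close> gives continuity of the induced map.  For \<open>F_map\<close> the roles of \<open>S\<close> and
  \<open>T\<close> are exchanged, in accordance with the reversed order on \<open>F_set\<close>.

  The homotopy part reduces to the order part.  Comparable continuous maps into a finite space are
  homotopic, by switching from the smaller to the larger one at the last moment
  (\<open>homotopic_if_specialization\<close>).  Conversely, let \<open>h\<close> be a homotopy between maps of finite spaces.
  Since minimal open sets are open, \<open>h\<^sub>s \<le> h\<^sub>t\<close> for all \<open>s\<close> near \<open>t\<close>.  An equivalence relation on
  \<open>[0,1]\<close> whose classes are neighbourhoods of their points is trivial, so any construction that
  takes comparable maps to homotopic ones takes homotopic maps to homotopic ones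
  (\<open>homotopic_transfer\<close>), without first extracting a fence of comparable maps.
\<close>

section \<open>Cells of a family of cones\<close>

text \<open>For \<open>K = min_open X\<close> these are the maximal points, for \<open>K = min_closed X\<close> the minimal ones.\<close>

definition apexes :: "'a topology \<Rightarrow> ('a \<Rightarrow> 'a set) \<Rightarrow> 'a set" where
  "apexes X K = {x \<in> topspace X. \<forall>y\<in>topspace X. K x \<subseteq> K y \<longrightarrow> y = x}"

definition cells :: "'a topology \<Rightarrow> ('a \<Rightarrow> 'a set) \<Rightarrow> 'a set set" where
  "cells X K = {C. \<exists>A. A \<noteq> {} \<and> A \<subseteq> apexes X K \<and> (\<Inter>a\<in>A. K a) \<noteq> {} \<and>
                     C \<in> connected_components_of (subtopology X (\<Inter>a\<in>A. K a))}"

definition cell_hull :: "'a topology \<Rightarrow> ('a \<Rightarrow> 'a set) \<Rightarrow> 'a set \<Rightarrow> 'a set" where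
  "cell_hull X K S = (LEAST D. D \<in> cells X K \<and> S \<subseteq> D)"

text \<open>These are the sets for which a least cell around them is shown to exist.\<close>

definition conical :: "'a topology \<Rightarrow> ('a \<Rightarrow> 'a set) \<Rightarrow> 'a set \<Rightarrow> bool" where
  "conical X K S \<longleftrightarrow> S \<noteq> {} \<and> connectedin X S \<and> (\<exists>x\<in>topspace X. S \<subseteq> K x)"

lemma apexes_subset_topspace: "apexes X K \<subseteq> topspace X"
  by (auto simp: apexes_def)

lemma conical_cell:
  assumes "C \<in> cells X K"
  shows "conical X K C"
proof -
  obtain A where A: "A \<noteq> {}" "A \<subseteq> apexes X K"
    and C: "C \<in> connected_components_of (subtopology X (\<Inter>a\<in>A. K a))"
    using assms by (auto simp: cells_def)
  obtain a where "a \<in> A" "a \<in> topspace X"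
    using A apexes_subset_topspace[of X K] by blast
  moreover have "connectedin X C" "C \<subseteq> (\<Inter>a\<in>A. K a)"
    using connectedin_connected_components_of[OF C] by (auto simp: connectedin_subtopology)
  ultimately show ?thesis
    using nonempty_connected_components_of[OF C] unfolding conical_def by blast
qed

lemma cell_subset_topspace: "C \<in> cells X K \<Longrightarrow> C \<subseteq> topspace X"
  by (drule conical_cell) (simp add: conical_def connectedin_subset_topspace)

lemma conical_image:
  assumes "conical X K S" "continuous_map X Y f"
    and "\<And>x. x \<in> topspace X \<Longrightarrow> f ` K x \<subseteq> L (f x)"
  shows "conical Y L (f ` S)"
proof -
  obtain x where x: "x \<in> topspace X" "S \<subseteq> K x"
    using assms(1) by (auto simp: conical_def)
  have "f ` S \<subseteq> L (f x)"
    using x assms(3)[OF x(1)] by blast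
  moreover have "f x \<in> topspace Y"
    using x assms(2) by (auto simp: continuous_map_def)
  moreover have "connectedin Y (f ` S)"
    using assms(1,2) connectedin_continuous_map_image by (auto simp: conical_def)
  ultimately show ?thesis
    using assms(1) by (auto simp: conical_def)
qed

locale cone_family =
  fixes X :: "'a topology" and K :: "'a \<Rightarrow> 'a set"
  assumes finite_space: "finite (topspace X)"
    and apex_in_cone: "x \<in> topspace X \<Longrightarrow> x \<in> K x"
    and cone_mono: "\<lbrakk>x \<in> topspace X; y \<in> K x\<rbrakk> \<Longrightarrow> K y \<subseteq> K x"
    and connectedin_cone: "x \<in> topspace X \<Longrightarrow> connectedin X (K x)"
    and inj_cone: "inj_on K (topspace X)"
begin

text \<open>An inclusion-maximal cone \<open>K a\<close> has \<open>a\<close> as its only apex because \<open>K\<close> is injective; this is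
  where the \<open>T\<^sub>0\<close> axiom enters.\<close>

lemma ex_apex:
  assumes "x \<in> topspace X"
  shows "\<exists>a\<in>apexes X K. K x \<subseteq> K a"
proof -
  obtain M where "M \<in> K ` topspace X" "K x \<subseteq> M"
    and M: "\<forall>N\<in>K ` topspace X. M \<subseteq> N \<longrightarrow> M = N"
    using finite_has_maximal2[of "K ` topspace X" "K x"] finite_space assms by auto
  then obtain a where a: "a \<in> topspace X" "M = K a"
    by blast
  have "a \<in> apexes X K"
    using a M inj_cone by (auto simp: apexes_def inj_on_def)
  then show ?thesis
    using \<open>K x \<subseteq> M\<close> a by blast
qed

text \<open>The cone of a point of \<open>C\<close> stays inside every maximal cone around \<open>C\<close> and is connected, so it
  cannot leave the component \<open>C\<close>.\<close>

lemma cone_subset_cell: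
  assumes "C \<in> cells X K" "x \<in> C"
  shows "K x \<subseteq> C"
proof -
  obtain A where A: "A \<subseteq> apexes X K"
    and C: "C \<in> connected_components_of (subtopology X (\<Inter>a\<in>A. K a))"
    using assms by (auto simp: cells_def)
  have "x \<in> topspace X" "x \<in> (\<Inter>a\<in>A. K a)"
    using connected_components_of_subset[OF C] assms(2) by auto
  then have "K x \<subseteq> (\<Inter>a\<in>A. K a)"
    using cone_mono A apexes_subset_topspace[of X K] by blast
  then have "connectedin (subtopology X (\<Inter>a\<in>A. K a)) (K x)"
    by (simp add: connectedin_subtopology connectedin_cone[OF \<open>x \<in> topspace X\<close>])
  moreover have "\<not> disjnt C (K x)"
    using assms(2) apex_in_cone[OF \<open>x \<in> topspace X\<close>] by (auto simp: disjnt_def)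
  ultimately show ?thesis
    using connected_components_of_maximal[OF C] by blast
qed

text \<open>Using all maximal cones around \<open>S\<close> makes their intersection as small as possible; any other
  cell around \<open>S\<close> comes from fewer cones, hence is a component of a larger set.\<close>

lemma ex_least_cell:
  assumes "conical X K S"
  shows "\<exists>D\<in>cells X K. S \<subseteq> D \<and> (\<forall>D'\<in>cells X K. S \<subseteq> D' \<longrightarrow> D \<subseteq> D')"
proof -
  have S: "S \<noteq> {}" "connectedin X S"
    using assms by (auto simp: conical_def)
  define B where "B = {b \<in> apexes X K. S \<subseteq> K b}"
  have "B \<noteq> {}"
    using assms ex_apex unfolding conical_def B_def by blast
  have SB: "S \<subseteq> (\<Inter>b\<in>B. K b)"
    by (auto simp: B_def)
  have "connectedin (subtopology X (\<Inter>b\<in>B. K b)) S"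
    using S SB by (simp add: connectedin_subtopology)
  moreover from this have "subtopology X (\<Inter>b\<in>B. K b) \<noteq> trivial_topology"
    using S(1) connectedin_subset_topspace by fastforce
  ultimately obtain D where D: "D \<in> connected_components_of (subtopology X (\<Inter>b\<in>B. K b))" "S \<subseteq> D"
    using exists_connected_component_of_superset by blast
  have "B \<subseteq> apexes X K" "(\<Inter>b\<in>B. K b) \<noteq> {}"
    using S(1) SB by (auto simp: B_def)
  then have "D \<in> cells X K"
    using D(1) \<open>B \<noteq> {}\<close> unfolding cells_def by blast
  moreover have "D \<subseteq> D'" if D': "D' \<in> cells X K" "S \<subseteq> D'" for D'
  proof -
    obtain A where A: "A \<subseteq> apexes X K"
      and comp: "D' \<in> connected_components_of (subtopology X (\<Inter>a\<in>A. K a))"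
      using D'(1) by (auto simp: cells_def)
    have "S \<subseteq> (\<Inter>a\<in>A. K a)"
      using D'(2) connected_components_of_subset[OF comp] by auto
    then have "A \<subseteq> B"
      using A by (auto simp: B_def)
    moreover have "connectedin X D" "D \<subseteq> (\<Inter>b\<in>B. K b)"
      using connectedin_connected_components_of[OF D(1)] by (auto simp: connectedin_subtopology)
    ultimately have "connectedin (subtopology X (\<Inter>a\<in>A. K a)) D"
      unfolding connectedin_subtopology by blast
    moreover have "\<not> disjnt D' D"
      using S(1) D(2) D'(2) by (auto simp: disjnt_def)
    ultimately show ?thesis
      using connected_components_of_maximal[OF comp] by blast
  qed
  ultimately show ?thesis
    using D(2) by blast
qed

lemma
  assumes "conical X K S"
  shows cell_hull_in_cells: "cell_hull X K S \<in> cells X K"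
    and subset_cell_hull: "S \<subseteq> cell_hull X K S"
    and cell_hull_least: "\<And>D. \<lbrakk>D \<in> cells X K; S \<subseteq> D\<rbrakk> \<Longrightarrow> cell_hull X K S \<subseteq> D"
proof -
  obtain D where D: "D \<in> cells X K" "S \<subseteq> D" "\<And>D'. \<lbrakk>D' \<in> cells X K; S \<subseteq> D'\<rbrakk> \<Longrightarrow> D \<subseteq> D'"
    using ex_least_cell[OF assms] by blast
  then have "cell_hull X K S = D"
    unfolding cell_hull_def by (intro Least_equality) auto
  then show "cell_hull X K S \<in> cells X K" "S \<subseteq> cell_hull X K S"
    "\<And>D. \<lbrakk>D \<in> cells X K; S \<subseteq> D\<rbrakk> \<Longrightarrow> cell_hull X K S \<subseteq> D"
    using D by auto
qed

lemma cell_hull_mono: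
  assumes S: "conical X K S" and T: "conical X K T"
    and ST: "\<And>s. s \<in> S \<Longrightarrow> \<exists>t\<in>T. s \<in> K t"
  shows "cell_hull X K S \<subseteq> cell_hull X K T"
proof (rule cell_hull_least[OF S cell_hull_in_cells[OF T]])
  show "S \<subseteq> cell_hull X K T"
    using ST cone_subset_cell[OF cell_hull_in_cells[OF T]] subset_cell_hull[OF T] by blast
qed

end

section \<open>Minimal open and minimal closed sets as cones\<close>

lemma openin_min_open:
  assumes "finite (topspace X)" "x \<in> topspace X"
  shows "openin X (min_open X x)"
proof -
  have "{U. openin X U \<and> x \<in> U} \<subseteq> Pow (topspace X)"
    using openin_subset by blast
  then have "finite {U. openin X U \<and> x \<in> U}"
    using assms(1) finite_subset by blast
  then show ?thesis
    unfolding min_open_def using assms(2) by (intro openin_Inter) auto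
qed

lemma in_min_open: "x \<in> min_open X x"
  by (auto simp: min_open_def)

lemma min_open_least: "\<lbrakk>openin X U; x \<in> U\<rbrakk> \<Longrightarrow> min_open X x \<subseteq> U"
  by (auto simp: min_open_def)

lemma in_min_open_iff_in_min_closed:
  assumes "x \<in> topspace X" "y \<in> topspace X"
  shows "x \<in> min_open X y \<longleftrightarrow> y \<in> min_closed X x"
  using assms by (auto simp: min_open_def min_closed_def in_closure_of)

lemma min_open_mono:
  assumes "finite (topspace X)" "y \<in> topspace X" "x \<in> min_open X y"
  shows "min_open X x \<subseteq> min_open X y"
  by (rule min_open_least[OF openin_min_open[OF assms(1,2)] assms(3)])

lemma min_closed_mono: "y \<in> min_closed X x \<Longrightarrow> min_closed X y \<subseteq> min_closed X x"
  unfolding min_closed_def by (rule closure_of_minimal) auto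

lemma space_le_iff:
  assumes "finite (topspace X)"
  shows "space_le X x y \<longleftrightarrow> y \<in> topspace X \<and> x \<in> min_open X y"
  unfolding space_le_def
proof (intro iffI conjI; (elim conjE)?)
  assume "y \<in> topspace X" "x \<in> min_open X y"
  then show "x \<in> topspace X" "min_open X x \<subseteq> min_open X y"
    using min_open_mono[OF assms] min_open_least[OF openin_topspace, of y X] by blast+
qed (use in_min_open[of x X] in auto)

lemma cone_family_min_open:
  assumes "finite (topspace X)" "t0_space X"
  shows "cone_family X (min_open X)"
proof
  show "connectedin X (min_open X x)" if x: "x \<in> topspace X" for x
    unfolding connectedin
  proof (intro conjI notI; (elim exE conjE)?)
    show "min_open X x \<subseteq> topspace X"
      by (rule min_open_least[OF openin_topspace x])
    \<comment> \<open>Whichever of the two open sets contains \<open>x\<close> contains all of \<open>min_open X x\<close>.\<close>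
    fix E1 E2
    assume E: "openin X E1" "openin X E2" "min_open X x \<subseteq> E1 \<union> E2" "E1 \<inter> E2 \<inter> min_open X x = {}"
      "E1 \<inter> min_open X x \<noteq> {}" "E2 \<inter> min_open X x \<noteq> {}"
    have "x \<in> E1 \<or> x \<in> E2"
      using E(3) in_min_open[of x X] by blast
    then have "min_open X x \<subseteq> E1 \<or> min_open X x \<subseteq> E2"
      using min_open_least E(1,2) by metis
    then show False
      using E(4-6) by blast
  qed
  show "inj_on (min_open X) (topspace X)"
  proof (rule inj_onI, rule ccontr)
    fix x y
    assume *: "x \<in> topspace X" "y \<in> topspace X" "min_open X x = min_open X y" "x \<noteq> y"
    then obtain U where "openin X U" "x \<notin> U \<longleftrightarrow> y \<in> U"
      using assms(2) unfolding t0_space_def by blast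
    then show False
      using min_open_least[of X U x] min_open_least[of X U y] in_min_open[of x X] in_min_open[of y X] *(3)
      by auto
  qed
qed (rule assms(1) in_min_open min_open_mono[OF assms(1)], assumption?)+

lemma cone_family_min_closed:
  assumes "finite (topspace X)" "t0_space X"
  shows "cone_family X (min_closed X)"
proof
  show "x \<in> min_closed X x" if "x \<in> topspace X" for x
    using that by (auto simp: min_closed_def in_closure_of)
  show "connectedin X (min_closed X x)" if "x \<in> topspace X" for x
    unfolding min_closed_def using that by (simp add: connectedin_closure_of)
  show "inj_on (min_closed X) (topspace X)"
    using assms(2) by (simp add: t0_space_closure_of_sing min_closed_def inj_on_def)
qed (rule assms(1) min_closed_mono, assumption?)+

lemma min_open_subset_iff_min_closed_subset:
  assumes "finite (topspace X)" "x \<in> topspace X" "y \<in> topspace X"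
  shows "min_open X x \<subseteq> min_open X y \<longleftrightarrow> min_closed X y \<subseteq> min_closed X x"
proof -
  have "y \<in> min_closed X y"
    using assms by (auto simp: min_closed_def in_closure_of)
  then show ?thesis
    using in_min_open_iff_in_min_closed[OF assms(2,3)] min_open_mono[OF assms(1,3)]
      min_closed_mono[of y X x] in_min_open[of x X] by blast
qed

lemma mxl_eq_apexes: "mxl X = apexes X (min_open X)"
  by (auto simp: mxl_def apexes_def space_le_def)

lemma mnl_eq_apexes:
  assumes "finite (topspace X)"
  shows "mnl X = apexes X (min_closed X)"
  using min_open_subset_iff_min_closed_subset[OF assms]
  by (auto simp: mnl_def apexes_def space_le_def)

lemma U_set_eq_cells: "U_set X = cells X (min_open X)"
  by (simp add: U_set_def cells_def U_of_def mxl_eq_apexes)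

lemma F_set_eq_cells: "finite (topspace X) \<Longrightarrow> F_set X = cells X (min_closed X)"
  by (simp add: F_set_def cells_def F_of_def mnl_eq_apexes)

lemma U_map_eq_cell_hull: "U_map Y f C = cell_hull Y (min_open Y) (f ` C)"
  by (simp add: U_map_def cell_hull_def U_set_eq_cells)

lemma F_map_eq_cell_hull:
  "finite (topspace Y) \<Longrightarrow> F_map Y f C = cell_hull Y (min_closed Y) (f ` C)"
  by (simp add: F_map_def cell_hull_def F_set_eq_cells)

lemma image_min_open_subset:
  assumes "finite (topspace Y)" "continuous_map X Y f" "x \<in> topspace X"
  shows "f ` min_open X x \<subseteq> min_open Y (f x)"
proof -
  have "f x \<in> topspace Y"
    using assms by (auto simp: continuous_map_def)
  then have "openin X {z \<in> topspace X. f z \<in> min_open Y (f x)}"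
    by (intro openin_continuous_map_preimage[OF assms(2)] openin_min_open[OF assms(1)])
  then have "min_open X x \<subseteq> {z \<in> topspace X. f z \<in> min_open Y (f x)}"
    using assms(3) by (intro min_open_least) (auto simp: in_min_open)
  then show ?thesis
    by blast
qed

lemma image_min_closed_subset:
  "continuous_map X Y f \<Longrightarrow> f ` min_closed X x \<subseteq> min_closed Y (f x)"
  using continuous_map_image_closure_subset[of X Y f "{x}"] by (simp add: min_closed_def)

section \<open>The induced maps\<close>

locale finite_T0_target =
  fixes X :: "'a topology" and Y :: "'b topology"
  assumes finX: "finite (topspace X)" and finY: "finite (topspace Y)" and t0Y: "t0_space Y"
begin

sublocale U: cone_family Y "min_open Y"
  by (rule cone_family_min_open[OF finY t0Y])

sublocale F: cone_family Y "min_closed Y"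
  by (rule cone_family_min_closed[OF finY t0Y])

lemma conical_image_U_set:
  "\<lbrakk>continuous_map X Y f; C \<in> U_set X\<rbrakk> \<Longrightarrow> conical Y (min_open Y) (f ` C)"
  using conical_image[OF conical_cell] image_min_open_subset[OF finY] by (metis U_set_eq_cells)

lemma conical_image_F_set:
  "\<lbrakk>continuous_map X Y f; C \<in> F_set X\<rbrakk> \<Longrightarrow> conical Y (min_closed Y) (f ` C)"
  using conical_image[OF conical_cell] image_min_closed_subset
  by (metis F_set_eq_cells[OF finX])

lemma U_set_subset_topspace: "C \<in> U_set X \<Longrightarrow> C \<subseteq> topspace X"
  by (simp add: U_set_eq_cells cell_subset_topspace)

lemma F_set_subset_topspace: "C \<in> F_set X \<Longrightarrow> C \<subseteq> topspace X"
  by (simp add: F_set_eq_cells[OF finX] cell_subset_topspace)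

text \<open>Allowing the map and the cell to grow together covers both uses: \<open>C = C'\<close> compares the induced
  maps of \<open>f\<close> and \<open>g\<close>, and \<open>f = g\<close> says that an induced map preserves the order.\<close>

lemma U_map_mono:
  assumes "continuous_map X Y f" "continuous_map X Y g"
    and "pointwise_le (topspace X) (space_le Y) f g" and "U_le X C C'"
  shows "U_le Y (U_map Y f C) (U_map Y g C')"
proof -
  have C: "C \<in> U_set X" "C' \<in> U_set X" "C \<subseteq> C'"
    using assms(4) by (auto simp: U_le_def)
  have "\<exists>t\<in>g ` C'. s \<in> min_open Y t" if "s \<in> f ` C" for s
    using that C(3) U_set_subset_topspace[OF C(1)] assms(3)
    by (auto simp: pointwise_le_def space_le_iff[OF finY])
  then show ?thesis
    unfolding U_le_def U_map_eq_cell_hull U_set_eq_cells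
    using C assms(1,2) U.cell_hull_mono U.cell_hull_in_cells conical_image_U_set by simp
qed

text \<open>If \<open>f \<le> g\<close>, then \<open>g x\<close> lies in the closed cone of \<open>f x\<close>, so it is the hull for \<open>g\<close> that is the
  smaller set.\<close>

lemma F_map_mono:
  assumes "continuous_map X Y f" "continuous_map X Y g"
    and "pointwise_le (topspace X) (space_le Y) f g" and "F_le X C C'"
  shows "F_le Y (F_map Y f C) (F_map Y g C')"
proof -
  have C: "C \<in> F_set X" "C' \<in> F_set X" "C' \<subseteq> C"
    using assms(4) by (auto simp: F_le_def)
  have "\<exists>t\<in>f ` C. s \<in> min_closed Y t" if "s \<in> g ` C'" for s
  proof -
    obtain x where x: "x \<in> C'" "s = g x"
      using \<open>s \<in> g ` C'\<close> by blast
    then have "x \<in> topspace X"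
      using F_set_subset_topspace[OF C(2)] by blast
    then have "space_le Y (f x) (g x)"
      using assms(3) by (simp add: pointwise_le_def)
    then have "f x \<in> topspace Y" "g x \<in> topspace Y" "f x \<in> min_open Y (g x)"
      using space_le_iff[OF finY] by (auto simp: space_le_def)
    then have "g x \<in> min_closed Y (f x)"
      using in_min_open_iff_in_min_closed by metis
    then show ?thesis
      using x C(3) by blast
  qed
  then show ?thesis
    unfolding F_le_def F_map_eq_cell_hull[OF finY] F_set_eq_cells[OF finY]
    using C assms(1,2) F.cell_hull_mono F.cell_hull_in_cells conical_image_F_set by simp
qed

text \<open>The only comparisons not covered by \<open>U_map_mono\<close> and \<open>F_map_mono\<close> are those between
  \<open>C \<in> F_set X\<close> and \<open>C' \<in> U_set X\<close> with a common point \<open>x\<close>.  There \<open>f x\<close> lies in \<open>F_map Y f C\<close>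
  and in \<open>U_map Y f C'\<close>, and the latter is contained in \<open>U_map Y g C'\<close>.\<close>

lemma C_map_mono:
  assumes "continuous_map X Y f" "continuous_map X Y g"
    and "pointwise_le (topspace X) (space_le Y) f g"
    and disj: "U_set X \<inter> F_set X = {}" and "C_le X C C'"
  shows "C_le Y (C_map X Y f C) (C_map X Y g C')"
proof -
  consider (UU) "U_le X C C'" | (FF) "F_le X C C'" | (FU) "C \<in> F_set X" "C' \<in> U_set X" "C \<inter> C' \<noteq> {}"
    using \<open>C_le X C C'\<close> unfolding C_le_def by blast
  then show ?thesis
  proof cases
    case UU
    then show ?thesis
      using U_map_mono[OF assms(1-3) UU] by (simp add: C_le_def C_map_def U_le_def)
  next
    case FF
    then have "C \<notin> U_set X" "C' \<notin> U_set X"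
      using disj by (auto simp: F_le_def)
    then show ?thesis
      using F_map_mono[OF assms(1-3) FF] by (simp add: C_le_def C_map_def)
  next
    case FU
    then have "C \<notin> U_set X"
      using disj by blast
    have "F_map Y f C \<in> F_set Y" "f ` C \<subseteq> F_map Y f C"
      using F.cell_hull_in_cells F.subset_cell_hull conical_image_F_set[OF assms(1) FU(1)]
      by (simp_all add: F_map_eq_cell_hull[OF finY] F_set_eq_cells[OF finY])
    moreover have "f ` C' \<subseteq> U_map Y f C'"
      using U.subset_cell_hull conical_image_U_set[OF assms(1) FU(2)]
      by (simp add: U_map_eq_cell_hull)
    moreover have "U_le Y (U_map Y f C') (U_map Y g C')"
      by (rule U_map_mono[OF assms(1-3)]) (simp add: U_le_def FU(2))
    ultimately have "F_map Y f C \<in> F_set Y" "U_map Y g C' \<in> U_set Y"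
      "F_map Y f C \<inter> U_map Y g C' \<noteq> {}"
      using FU(3) by (auto simp: U_le_def)
    then show ?thesis
      using FU \<open>C \<notin> U_set X\<close> by (simp add: C_le_def C_map_def)
  qed
qed

end

section \<open>Comparable maps and homotopies\<close>

text \<open>The homotopy is \<open>f\<close> at all times \<open>t < 1\<close> and \<open>g\<close> at time \<open>1\<close>.  The preimage of an open set \<open>V\<close>
  is then a union of two open boxes: the hypothesis puts the preimage of \<open>V\<close> under \<open>g\<close> inside the
  one under \<open>f\<close>.\<close>

lemma homotopic_if_specialization:
  assumes f: "continuous_map X Y f" and g: "continuous_map X Y g"
    and le: "\<And>x V. \<lbrakk>x \<in> topspace X; openin Y V; g x \<in> V\<rbrakk> \<Longrightarrow> f x \<in> V"
  shows "homotopic X Y f g"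
proof -
  define h where "h = (\<lambda>(t::real, x). if t < 1 then f x else g x)"
  let ?I = "top_of_set {0..1::real}"
  have "continuous_map (prod_topology ?I X) Y h"
    unfolding continuous_map
  proof (intro conjI allI impI)
    show "h ` topspace (prod_topology ?I X) \<subseteq> topspace Y"
      using f g by (auto simp: h_def continuous_map_def)
    fix V
    assume V: "openin Y V"
    have "{p \<in> topspace (prod_topology ?I X). h p \<in> V} =
        {0..1} \<times> {x \<in> topspace X. g x \<in> V} \<union> {0..<1} \<times> {x \<in> topspace X. f x \<in> V}"
      using le[OF _ V] by (auto simp: h_def split: if_splits)
    moreover have "openin ?I {0..1}" "openin ?I {0..<1}"
    proof -
      show "openin ?I {0..1}"
        by simp
      have "{0..<1} = {0..1} \<inter> {..<1::real}"
        by auto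
      then show "openin ?I {0..<1}"
        by (metis open_lessThan openin_open_Int)
    qed
    ultimately show "openin (prod_topology ?I X) {p \<in> topspace (prod_topology ?I X). h p \<in> V}"
      using openin_continuous_map_preimage[OF f V] openin_continuous_map_preimage[OF g V]
      by (simp add: openin_Un openin_prod_Times_iff)
  qed
  then show ?thesis
    unfolding homotopic_with_def by (intro exI[of _ h]) (auto simp: h_def)
qed

lemma continuous_map_downset_topology:
  assumes "\<And>x. x \<in> P \<Longrightarrow> f x \<in> Q"
    and "\<And>x y. \<lbrakk>x \<in> P; y \<in> P; le x y\<rbrakk> \<Longrightarrow> le' (f x) (f y)"
  shows "continuous_map (downset_topology P le) (downset_topology Q le') f"
  using assms by (force simp: continuous_map openin_downset_topology topspace_downset_topology)

text \<open>An open set of \<open>downset_topology Q le'\<close> is closed under single steps of \<open>le'\<close>, so a pointwise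
  comparison by \<open>le'\<close> is what \<open>homotopic_if_specialization\<close> asks for.\<close>

lemma homotopic_downset_topology:
  assumes "\<And>x. x \<in> P \<Longrightarrow> f x \<in> Q" "\<And>x. x \<in> P \<Longrightarrow> g x \<in> Q"
    and "\<And>x y. \<lbrakk>x \<in> P; y \<in> P; le x y\<rbrakk> \<Longrightarrow> le' (f x) (f y)"
    and "\<And>x y. \<lbrakk>x \<in> P; y \<in> P; le x y\<rbrakk> \<Longrightarrow> le' (g x) (g y)"
    and "\<And>x. x \<in> P \<Longrightarrow> le' (f x) (g x)"
  shows "homotopic (downset_topology P le) (downset_topology Q le') f g"
  by (rule homotopic_if_specialization; (intro continuous_map_downset_topology)?)
    (use assms in \<open>auto simp: openin_downset_topology topspace_downset_topology\<close>)

text \<open>For each of the finitely many points \<open>x\<close>, the times \<open>s\<close> with \<open>h\<^sub>s x \<in> min_open Y (h\<^sub>t x)\<close> form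
  an open set containing \<open>t\<close>; on their intersection \<open>h\<^sub>s \<le> h\<^sub>t\<close>.\<close>

lemma homotopy_locally_below:
  assumes finX: "finite (topspace X)" and finY: "finite (topspace Y)"
    and h: "continuous_map (prod_topology T X) Y h" and t: "t \<in> topspace T"
  shows "\<exists>N. openin T N \<and> t \<in> N \<and>
    (\<forall>s\<in>N. pointwise_le (topspace X) (space_le Y) (\<lambda>x. h (s, x)) (\<lambda>x. h (t, x)))"
proof -
  define N where "N = (\<Inter>x\<in>topspace X. {s \<in> topspace T. h (s, x) \<in> min_open Y (h (t, x))}) \<inter> topspace T"
  have top: "h (t, x) \<in> topspace Y" if "x \<in> topspace X" for x
    using that h t by (auto simp: continuous_map_def)
  have "openin T {s \<in> topspace T. h (s, x) \<in> min_open Y (h (t, x))}" if "x \<in> topspace X" for x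
  proof (rule openin_continuous_map_preimage)
    have "continuous_map T (prod_topology T X) (\<lambda>s. (s, x))"
      using that by (simp add: continuous_map_pairedI)
    from continuous_map_compose[OF this h] show "continuous_map T Y (\<lambda>s. h (s, x))"
      by (simp add: o_def)
    show "openin Y (min_open Y (h (t, x)))"
      by (rule openin_min_open[OF finY top[OF that]])
  qed
  then have "openin T N"
    unfolding N_def using finX by (intro openin_INT) auto
  moreover have "t \<in> N"
    using t by (auto simp: N_def in_min_open)
  ultimately show ?thesis
    using top by (intro exI[of _ N]) (auto simp: N_def pointwise_le_def space_le_iff[OF finY])
qed

text \<open>Near each time \<open>t\<close> the maps \<open>h\<^sub>s\<close> are below \<open>h\<^sub>t\<close>, so \<open>\<Phi> h\<^sub>s\<close> is homotopic to \<open>\<Phi> h\<^sub>t\<close>.  Being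
  homotopic after \<open>\<Phi>\<close> is thus a locally constant equivalence relation on the connected set \<open>[0,1]\<close>.\<close>

lemma homotopic_transfer:
  fixes \<Phi> :: "('a \<Rightarrow> 'b) \<Rightarrow> 'c \<Rightarrow> 'd"
  assumes finX: "finite (topspace X)" and finY: "finite (topspace Y)"
    and step: "\<And>f g. \<lbrakk>continuous_map X Y f; continuous_map X Y g;
      pointwise_le (topspace X) (space_le Y) f g\<rbrakk> \<Longrightarrow> homotopic Z W (\<Phi> f) (\<Phi> g)"
    and "homotopic X Y f g"
  shows "homotopic Z W (\<Phi> f) (\<Phi> g)"
proof -
  let ?I = "top_of_set {0..1::real}"
  obtain h where h: "continuous_map (prod_topology ?I X) Y h"
    and h0: "\<And>x. h (0, x) = f x" and h1: "\<And>x. h (1, x) = g x"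
    using \<open>homotopic X Y f g\<close> unfolding homotopic_with_def by blast
  have cont: "continuous_map X Y (\<lambda>x. h (t, x))" if "t \<in> {0..1}" for t
  proof -
    have "continuous_map X (prod_topology ?I X) (\<lambda>x. (t, x))"
      using that by (simp add: continuous_map_pairedI)
    from continuous_map_compose[OF this h] show ?thesis
      by (simp add: o_def)
  qed
  define R where "R s t = homotopic Z W (\<Phi> (\<lambda>x. h (s, x))) (\<Phi> (\<lambda>x. h (t, x)))" for s t
  have "R 0 1"
  proof (rule connected_equivalence_relation[of "{0..1::real}"])
    show "R t s" if "R s t" for s t
      using that unfolding R_def by (rule homotopic_with_symD)
    show "R r t" if "R r s" "R s t" for r s t
      using that unfolding R_def by (rule homotopic_with_trans)
    fix t :: real
    assume t: "t \<in> {0..1}"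
    then obtain N where N: "openin ?I N" "t \<in> N"
      and below: "\<And>s. s \<in> N \<Longrightarrow>
        pointwise_le (topspace X) (space_le Y) (\<lambda>x. h (s, x)) (\<lambda>x. h (t, x))"
      using homotopy_locally_below[OF finX finY h, of t] by auto
    have "R t s" if "s \<in> N" for s
    proof -
      have "s \<in> {0..1}"
        using that openin_subset[OF N(1)] by auto
      then show ?thesis
        unfolding R_def using homotopic_with_symD[OF step[OF cont cont below[OF that]]] t by simp
    qed
    then show "\<exists>N. openin ?I N \<and> t \<in> N \<and> (\<forall>s\<in>N. R t s)"
      using N by blast
  qed auto
  then show ?thesis
    by (simp add: R_def h0 h1)
qed

section \<open>Invariance of the induced maps\<close>

theorem proposition3p23:
  fixes X :: "'a topology" and Y :: "'b topology" and f g :: "'a \<Rightarrow> 'b"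
  assumes "finite (topspace X)" and "t0_space X"
    and "finite (topspace Y)" and "t0_space Y"
    and "continuous_map X Y f" and "continuous_map X Y g"
  shows "(pointwise_le (topspace X) (space_le Y) f g \<longrightarrow>
            pointwise_le (U_set X) (U_le Y) (U_map Y f) (U_map Y g) \<and>
            pointwise_le (F_set X) (F_le Y) (F_map Y f) (F_map Y g))
       \<and> (pointwise_le (topspace X) (space_le Y) f g \<and> U_set X \<inter> F_set X = {} \<longrightarrow>
            pointwise_le (C_set X) (C_le Y) (C_map X Y f) (C_map X Y g))
       \<and> (homotopic X Y f g \<longrightarrow>
            homotopic (U_space X) (U_space Y) (U_map Y f) (U_map Y g) \<and>
            homotopic (F_space X) (F_space Y) (F_map Y f) (F_map Y g))
       \<and> (homotopic X Y f g \<and> U_set X \<inter> F_set X = {} \<longrightarrow>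
            homotopic (C_space X) (C_space Y) (C_map X Y f) (C_map X Y g))"
proof -
  interpret finite_T0_target X Y
    using assms by unfold_locales
  have refl: "pointwise_le (topspace X) (space_le Y) k k" if "continuous_map X Y k" for k
    using that by (auto simp: pointwise_le_def space_le_def continuous_map_def)

  have U: "pointwise_le (U_set X) (U_le Y) (U_map Y f) (U_map Y g)"
    if "continuous_map X Y f" "continuous_map X Y g"
      "pointwise_le (topspace X) (space_le Y) f g" for f g
    unfolding pointwise_le_def by (intro ballI U_map_mono[OF that]) (simp add: U_le_def)
  have F: "pointwise_le (F_set X) (F_le Y) (F_map Y f) (F_map Y g)"
    if "continuous_map X Y f" "continuous_map X Y g"
      "pointwise_le (topspace X) (space_le Y) f g" for f g
    unfolding pointwise_le_def by (intro ballI F_map_mono[OF that]) (simp add: F_le_def)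
  have C: "pointwise_le (C_set X) (C_le Y) (C_map X Y f) (C_map X Y g)"
    if "continuous_map X Y f" "continuous_map X Y g"
      "pointwise_le (topspace X) (space_le Y) f g" "U_set X \<inter> F_set X = {}" for f g
    unfolding pointwise_le_def
    by (intro ballI C_map_mono[OF that]) (auto simp: C_set_def C_le_def U_le_def F_le_def)

  have "homotopic (U_space X) (U_space Y) (U_map Y f) (U_map Y g)" if "homotopic X Y f g"
  proof (rule homotopic_transfer[OF finX finY _ that])
    fix f g
    assume fg: "continuous_map X Y f" "continuous_map X Y g"
      "pointwise_le (topspace X) (space_le Y) f g"
    show "homotopic (U_space X) (U_space Y) (U_map Y f) (U_map Y g)"
      unfolding U_space_def using U[OF fg] fg refl U_map_mono
      by (intro homotopic_downset_topology) (auto simp: pointwise_le_def U_le_def)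
  qed
  moreover have "homotopic (F_space X) (F_space Y) (F_map Y f) (F_map Y g)" if "homotopic X Y f g"
  proof (rule homotopic_transfer[OF finX finY _ that])
    fix f g
    assume fg: "continuous_map X Y f" "continuous_map X Y g"
      "pointwise_le (topspace X) (space_le Y) f g"
    show "homotopic (F_space X) (F_space Y) (F_map Y f) (F_map Y g)"
      unfolding F_space_def using F[OF fg] fg refl F_map_mono
      by (intro homotopic_downset_topology) (auto simp: pointwise_le_def F_le_def)
  qed
  moreover have "homotopic (C_space X) (C_space Y) (C_map X Y f) (C_map X Y g)"
    if "homotopic X Y f g" and disj: "U_set X \<inter> F_set X = {}"
  proof (rule homotopic_transfer[OF finX finY _ \<open>homotopic X Y f g\<close>])
    fix f g
    assume fg: "continuous_map X Y f" "continuous_map X Y g"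
      "pointwise_le (topspace X) (space_le Y) f g"
    have C_le_set: "D \<in> C_set Y" "D' \<in> C_set Y" if "C_le Y D D'" for D D'
      using that by (auto simp: C_le_def U_le_def F_le_def C_set_def)
    have le: "C_le Y (C_map X Y f C) (C_map X Y g C)" if "C \<in> C_set X" for C
      using C[OF fg disj] that by (auto simp: pointwise_le_def)
    show "homotopic (C_space X) (C_space Y) (C_map X Y f) (C_map X Y g)"
      unfolding C_space_def
    proof (rule homotopic_downset_topology)
      show "C_map X Y f C \<in> C_set Y" "C_map X Y g C \<in> C_set Y" if "C \<in> C_set X" for C
        using C_le_set le[OF that] by blast+
      show "C_le Y (C_map X Y f C) (C_map X Y f C')" "C_le Y (C_map X Y g C) (C_map X Y g C')"
        if "C_le X C C'" for C C'
        using C_map_mono[OF _ _ refl disj that] fg by blast+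
    qed (rule le)
  qed
  ultimately show ?thesis
    using U F C assms(5,6) by blast
qed

end
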